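(* Let $P$ be an augmented program, $M$ a set of atoms and $\overline{M}=\sigma_P\setminus M$. Then $M$ is a min-answer set of $P$ (i.e. $M$ is both an answer set of $P$ and a minimal model of $P$) if and only if $P\cup\neg\overline{M}\ \vdash^c_I\ M$.
   Context: Formulas are propositional over atoms with $\land,\lor,\leftarrow$ (implication) and $\bot$; $\neg F$ abbreviates $\bot\leftarrow F$, $\top$ abbreviates $\bot\leftarrow\bot$. $\sigma_P$ is the set of atoms occurring in $P$. A nested formula is built from atoms, $\bot,\top$ using $\land,\lor,\neg$; an augmented program is a finite set of clauses $H\leftarrow B$ with $H,B$ nested formulas. Answer sets: basic formulas are built from atoms, $\bot,\top$ with $\land,\lor$. For a set of atoms $X$: $X\models a$ iff $a\in X$, $X\models\top$, $X\not\models\bot$, $X\models F\land G$ iff both, $X\models F\lor G$ iff either. $X$ is closed under a basic program $Q$ if for each $H\leftarrow B\in Q$, $X\models B$ implies $X\models H$; $X$ is an answer set of basic $Q$ if $\subseteq$-minimal among sets closed under $Q$. Reduct: $F^X=F$ for atoms, $\bot,\top$; $(F\land G)^X=F^X\land G^X$; $(F\lor G)^X=F^X\lor G^X$; $(\neg F)^X=\bot$ if $X\models F^X$, else $\top$; $(H\leftarrow B)^X=H^X\leftarrow B^X$; $P^X=\{C^X:C\in P\}$. $X$ is an answer set of augmented $P$ iff $X$ is an answer set of $P^X$. A set of atoms $M$ is a model of $P$ if the classical interpretation making exactly the atoms of $M$ true satisfies every clause of $P$; a minimal model if no proper subset is a model. For a set $X$ of atoms, $\neg X=\{\neg a:a\in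 X\}$. $T\vdash_I F$ means $(F_1\land\dots\land F_n)\to F$ is a theorem of intuitionistic logic for some $F_i\in T$; $T$ is consistent if not $T\vdash_I\bot$; $T\vdash^c_I U$ means $T$ is consistent and $T\vdash_I F$ for all $F\in U$. *)

theory Defs
  imports Main
begin

datatype (atoms: 'a) form =
    Atom 'a
  | Bot
  | And "'a form" "'a form"
  | Or "'a form" "'a form"
  | Imp "'a form" "'a form"  \<comment> \<open>\<open>Imp F G\<close> is \<open>G \<leftarrow> F\<close>\<close>

abbreviation Neg :: "'a form \<Rightarrow> 'a form" where
  "Neg F \<equiv> Imp F Bot"

abbreviation Top :: "'a form" where
  "Top \<equiv> Imp Bot Bot"

primrec sat :: "'a set \<Rightarrow> 'a form \<Rightarrow> bool" (infix \<open>\<Turnstile>\<close> 50) where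
  "X \<Turnstile> Atom a \<longleftrightarrow> a \<in> X"
| "X \<Turnstile> Bot \<longleftrightarrow> False"
| "X \<Turnstile> And F G \<longleftrightarrow> X \<Turnstile> F \<and> X \<Turnstile> G"
| "X \<Turnstile> Or F G \<longleftrightarrow> X \<Turnstile> F \<or> X \<Turnstile> G"
| "X \<Turnstile> Imp F G \<longleftrightarrow> (X \<Turnstile> F \<longrightarrow> X \<Turnstile> G)"

inductive basic :: "'a form \<Rightarrow> bool" where
  "basic (Atom a)"
| "basic Bot"
| "basic Top"
| "basic F \<Longrightarrow> basic G \<Longrightarrow> basic (And F G)"
| "basic F \<Longrightarrow> basic G \<Longrightarrow> basic (Or F G)"

inductive nested :: "'a form \<Rightarrow> bool" where
  "nested (Atom a)"
| "nested Bot"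
| "nested Top"
| "nested F \<Longrightarrow> nested G \<Longrightarrow> nested (And F G)"
| "nested F \<Longrightarrow> nested G \<Longrightarrow> nested (Or F G)"
| "nested F \<Longrightarrow> nested (Neg F)"

text \<open>
  Clauses are kept apart from formulas because a clause \<open>\<bottom> \<leftarrow> B\<close> and the nested formula \<open>\<not> B\<close>
  are the same formula but have different reducts.
\<close>

datatype 'a clause = Clause (head: "'a form") (body: "'a form")

definition clause_form :: "'a clause \<Rightarrow> 'a form" where
  "clause_form C = Imp (body C) (head C)"

definition basic_program :: "'a clause set \<Rightarrow> bool" where
  "basic_program Q \<longleftrightarrow> finite Q \<and> (\<forall>C\<in>Q. basic (head C) \<and> basic (body C))"

definition augmented_program :: "'a clause set \<Rightarrow> bool" where
  "augmented_program P \<longleftrightarrow> finite P \<and> (\<forall>C\<in>P. nested (head C) \<and> nested (body C))"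

definition program_atoms :: "'a clause set \<Rightarrow> 'a set" where
  "program_atoms P = (\<Union>C\<in>P. atoms (clause_form C))"

definition closed_under :: "'a set \<Rightarrow> 'a clause set \<Rightarrow> bool" where
  "closed_under X Q \<longleftrightarrow> (\<forall>C\<in>Q. X \<Turnstile> body C \<longrightarrow> X \<Turnstile> head C)"

definition basic_answer_set :: "'a clause set \<Rightarrow> 'a set \<Rightarrow> bool" where
  "basic_answer_set Q X \<longleftrightarrow> closed_under X Q \<and> (\<forall>Y. closed_under Y Q \<and> Y \<subseteq> X \<longrightarrow> Y = X)"

text \<open>
  On nested formulas the only implications are negations; the \<open>else\<close> branch below is
  a dummy. The reduct of \<open>\<top>\<close>, which is \<open>\<not> \<bottom>\<close> here, comes out as \<open>\<top>\<close>.
\<close>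

primrec reduct :: "'a set \<Rightarrow> 'a form \<Rightarrow> 'a form" where
  "reduct X (Atom a) = Atom a"
| "reduct X Bot = Bot"
| "reduct X (And F G) = And (reduct X F) (reduct X G)"
| "reduct X (Or F G) = Or (reduct X F) (reduct X G)"
| "reduct X (Imp F G) =
    (if G = Bot then (if X \<Turnstile> reduct X F then Bot else Top) else Imp F G)"

definition clause_reduct :: "'a set \<Rightarrow> 'a clause \<Rightarrow> 'a clause" where
  "clause_reduct X C = Clause (reduct X (head C)) (reduct X (body C))"

definition program_reduct :: "'a set \<Rightarrow> 'a clause set \<Rightarrow> 'a clause set" where
  "program_reduct X P = clause_reduct X ` P"

lemma basic_reduct: "nested F \<Longrightarrow> basic (reduct X F)"
  by (induction rule: nested.induct) (auto intro: basic.intros)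

lemma basic_program_reduct: "augmented_program P \<Longrightarrow> basic_program (program_reduct X P)"
  by (auto simp: augmented_program_def basic_program_def program_reduct_def clause_reduct_def
      intro: basic_reduct)

definition answer_set :: "'a clause set \<Rightarrow> 'a set \<Rightarrow> bool" where
  "answer_set P X \<longleftrightarrow> basic_answer_set (program_reduct X P) X"

definition model :: "'a clause set \<Rightarrow> 'a set \<Rightarrow> bool" where
  "model P M \<longleftrightarrow> (\<forall>C\<in>P. M \<Turnstile> clause_form C)"

definition minimal_model :: "'a clause set \<Rightarrow> 'a set \<Rightarrow> bool" where
  "minimal_model P M \<longleftrightarrow> model P M \<and> (\<forall>N. N \<subset> M \<longrightarrow> \<not> model P N)"

definition min_answer_set :: "'a clause set \<Rightarrow> 'a set \<Rightarrow> bool" where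
  "min_answer_set P M \<longleftrightarrow> answer_set P M \<and> minimal_model P M"

inductive int_thm :: "'a form \<Rightarrow> bool" where
  K: "int_thm (Imp F (Imp G F))"
| S: "int_thm (Imp (Imp F (Imp G H)) (Imp (Imp F G) (Imp F H)))"
| AndE1: "int_thm (Imp (And F G) F)"
| AndE2: "int_thm (Imp (And F G) G)"
| AndI: "int_thm (Imp F (Imp G (And F G)))"
| OrI1: "int_thm (Imp F (Or F G))"
| OrI2: "int_thm (Imp G (Or F G))"
| OrE: "int_thm (Imp (Imp F H) (Imp (Imp G H) (Imp (Or F G) H)))"
| BotE: "int_thm (Imp Bot F)"
| MP: "int_thm (Imp F G) \<Longrightarrow> int_thm F \<Longrightarrow> int_thm G"

fun conj_list :: "'a form list \<Rightarrow> 'a form" where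
  "conj_list [] = Top"
| "conj_list [F] = F"
| "conj_list (F # G # Fs) = And F (conj_list (G # Fs))"

definition int_derives :: "'a form set \<Rightarrow> 'a form \<Rightarrow> bool" (infix \<open>\<turnstile>\<^sub>I\<close> 50) where
  "T \<turnstile>\<^sub>I F \<longleftrightarrow> (\<exists>Fs. set Fs \<subseteq> T \<and> int_thm (Imp (conj_list Fs) F))"

definition consistent :: "'a form set \<Rightarrow> bool" where
  "consistent T \<longleftrightarrow> \<not> T \<turnstile>\<^sub>I Bot"

definition consistently_derives :: "'a form set \<Rightarrow> 'a form set \<Rightarrow> bool"
    (infix \<open>\<turnstile>\<^sup>c\<^sub>I\<close> 50) where
  "T \<turnstile>\<^sup>c\<^sub>I U \<longleftrightarrow> consistent T \<and> (\<forall>F\<in>U. T \<turnstile>\<^sub>I F)"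

end

(* Let T be P together with the negations of the atoms outside M.

   If T consistently derives M, soundness for here-and-there models (Y, M) turns every Y \<subseteq> M
   closed under the reduct into a superset of M, and soundness for classical models gives
   minimality.

   Conversely, if T does not derive a, extend T to a prime theory D omitting Atom a, and let Y be
   the set of its atoms. Every maximal consistent extension of T describes a classical model of P
   below M, hence M itself; so D contains a negation of a formula over the program atoms exactly if
   M satisfies it, and membership in D of a nested formula coincides with truth in Y of its reduct.
   Thus Y is closed under the reduct and below M, so Y = M, and a is not in M. *)
theory Submission
  imports Defs
begin

section \<open>Intuitionistic derivability\<close>

text \<open>Reformulates \<open>int_derives\<close> by rules, so that soundness and the deduction
  theorem can be proved by induction on derivations.\<close>

inductive derivable :: "'a form set \<Rightarrow> 'a form \<Rightarrow> bool" for T where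
  ax: "int_thm F \<Longrightarrow> derivable T F"
| hyp: "F \<in> T \<Longrightarrow> derivable T F"
| mp: "derivable T (Imp F G) \<Longrightarrow> derivable T F \<Longrightarrow> derivable T G"

lemma int_thm_refl: "int_thm (Imp F F)"
  by (rule int_thm.MP[OF int_thm.MP[OF int_thm.S[of F "Imp F F"]]]) (rule int_thm.K)+

lemma int_thm_distrib: "int_thm (Imp F (Imp G H)) \<Longrightarrow> int_thm (Imp F G) \<Longrightarrow> int_thm (Imp F H)"
  by (rule int_thm.MP[OF int_thm.MP[OF int_thm.S]])

lemma int_thm_trans: "int_thm (Imp F G) \<Longrightarrow> int_thm (Imp G H) \<Longrightarrow> int_thm (Imp F H)"
  by (rule int_thm_distrib[OF int_thm.MP[OF int_thm.K]])

text \<open>Serves to merge the premise lists of two derivations when modus ponens combines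
  them.\<close>

lemma int_thm_conj_list_append:
  "int_thm (Imp (conj_list (Fs @ Gs)) (conj_list Fs)) \<and>
   int_thm (Imp (conj_list (Fs @ Gs)) (conj_list Gs))"
proof (induction Fs rule: conj_list.induct)
  case 1
  then show ?case
    by (auto intro: int_thm_refl int_thm.MP[OF int_thm.K])
next
  case (2 F)
  show ?case
  proof (cases Gs)
    case Nil
    then show ?thesis
      by (auto intro: int_thm_refl int_thm.MP[OF int_thm.K])
  next
    case (Cons G Gs')
    then show ?thesis
      by (auto intro: int_thm.AndE1 int_thm.AndE2)
  qed
next
  case (3 F G Fs)
  let ?A = "conj_list (G # Fs @ Gs)"
  have A: "int_thm (Imp (And F ?A) (conj_list (G # Fs)))"
    "int_thm (Imp (And F ?A) (conj_list Gs))"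
    using 3 by (auto intro: int_thm_trans[OF int_thm.AndE2])
  have "int_thm (Imp (And F ?A) (Imp (conj_list (G # Fs)) (And F (conj_list (G # Fs)))))"
    by (rule int_thm_trans[OF int_thm.AndE1 int_thm.AndI])
  then have "int_thm (Imp (And F ?A) (And F (conj_list (G # Fs))))"
    using A(1) by (rule int_thm_distrib)
  then show ?case
    using A(2) by simp
qed

lemma derivable_conj_list: "set Fs \<subseteq> T \<Longrightarrow> derivable T (conj_list Fs)"
proof (induction Fs rule: conj_list.induct)
  case (3 F G Fs)
  then show ?case
    by (auto intro: derivable.mp[OF derivable.mp[OF derivable.ax[OF int_thm.AndI]]] derivable.hyp)
qed (auto intro: derivable.ax derivable.hyp int_thm_refl)

lemma int_derives_iff_derivable: "T \<turnstile>\<^sub>I F \<longleftrightarrow> derivable T F"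
proof
  assume "T \<turnstile>\<^sub>I F"
  then show "derivable T F"
    unfolding int_derives_def
    by (blast intro: derivable.mp derivable.ax derivable_conj_list)
next
  assume "derivable T F"
  then show "T \<turnstile>\<^sub>I F"
  proof induction
    case (ax F)
    then have "int_thm (Imp (conj_list []) F)"
      by (rule int_thm.MP[OF int_thm.K])
    then show ?case
      unfolding int_derives_def by (intro exI[of _ "[]"]) simp
  next
    case (hyp F)
    then have "set [F] \<subseteq> T" "int_thm (Imp (conj_list [F]) F)"
      by (auto intro: int_thm_refl)
    then show ?case
      unfolding int_derives_def by blast
  next
    case (mp F G)
    then obtain Fs Gs where "set (Fs @ Gs) \<subseteq> T"
      and "int_thm (Imp (conj_list Fs) (Imp F G))" "int_thm (Imp (conj_list Gs) F)"
      unfolding int_derives_def by auto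
    moreover from this have "int_thm (Imp (conj_list (Fs @ Gs)) G)"
      by (intro int_thm_distrib[of "conj_list (Fs @ Gs)" F G]
          int_thm_trans[OF int_thm_conj_list_append[THEN conjunct1]]
          int_thm_trans[OF int_thm_conj_list_append[THEN conjunct2]])
    ultimately show ?case
      unfolding int_derives_def by blast
  qed
qed

lemma derivable_mono: "derivable S F \<Longrightarrow> S \<subseteq> T \<Longrightarrow> derivable T F"
  by (induction rule: derivable.induct) (use derivable.ax derivable.hyp derivable.mp in blast)+

lemma derivable_finite: "derivable T F \<Longrightarrow> \<exists>S. finite S \<and> S \<subseteq> T \<and> derivable S F"
proof (induction rule: derivable.induct)
  case (ax F)
  then show ?case
    by (intro exI[of _ "{}"]) (simp add: derivable.ax)
next
  case (hyp F)
  then have "finite {F}" "{F} \<subseteq> T" "derivable {F} F"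
    by (auto intro: derivable.hyp)
  then show ?case by blast
next
  case (mp F G)
  then obtain S S' where "finite S" "S \<subseteq> T" "derivable S (Imp F G)"
    "finite S'" "S' \<subseteq> T" "derivable S' F" by blast
  then have "finite (S \<union> S')" "S \<union> S' \<subseteq> T" "derivable (S \<union> S') G"
    by (auto intro: derivable.mp derivable_mono)
  then show ?case by blast
qed

text \<open>Axiom \<open>K\<close> handles axioms and old hypotheses, \<open>int_thm_refl\<close>
  the discharged hypothesis, and \<open>S\<close> modus ponens.\<close>

lemma deduction: "derivable (insert F T) G \<Longrightarrow> derivable T (Imp F G)"
proof (induction rule: derivable.induct)
  case (ax G)
  then show ?case by (intro derivable.ax int_thm.MP[OF int_thm.K])
next
  case (hyp G)
  then show ?case
    by (auto intro: derivable.ax int_thm_refl derivable.mp[OF derivable.ax[OF int_thm.K]]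
        derivable.hyp)
next
  case (mp G H)
  then show ?case by (blast intro: derivable.mp[OF derivable.mp[OF derivable.ax[OF int_thm.S]]])
qed

section \<open>Prime theories\<close>

text \<open>Only maximality is demanded; deductive closure and primeness follow from it.\<close>

definition maximal_avoiding :: "'a form \<Rightarrow> 'a form set \<Rightarrow> bool" where
  "maximal_avoiding F D \<longleftrightarrow> \<not> derivable D F \<and> (\<forall>G. G \<notin> D \<longrightarrow> derivable (insert G D) F)"

text \<open>Zorn's lemma applies because a derivation uses finitely many hypotheses: those taken
  from the union of a chain already lie in one member.\<close>

lemma maximal_avoiding_extension:
  assumes "\<not> derivable T F"
  obtains D where "T \<subseteq> D" "maximal_avoiding F D"
proof -
  let ?A = "{D. T \<subseteq> D \<and> \<not> derivable D F}"
  have "\<exists>D\<in>?A. \<forall>E\<in>?A. D \<subseteq> E \<longrightarrow> E = D"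
  proof (rule subset_Zorn_nonempty)
    show "?A \<noteq> {}" using assms by blast
  next
    fix C assume C: "C \<noteq> {}" "subset.chain ?A C"
    have "\<not> derivable (\<Union>C) F"
    proof
      assume "derivable (\<Union>C) F"
      then obtain S where S: "finite S" "S \<subseteq> \<Union>C" "derivable S F"
        using derivable_finite by blast
      then obtain D where "D \<in> C" "S \<subseteq> D"
        using finite_subset_Union_chain[OF S(1,2) C(1,2)] by blast
      then show False
        using C(2) derivable_mono[OF S(3)] unfolding subset.chain_def by blast
    qed
    moreover have "C \<subseteq> ?A"
      using C(2) unfolding subset.chain_def by (rule conjunct1)
    then have "T \<subseteq> \<Union>C"
      using C(1) by blast
    ultimately show "\<Union>C \<in> ?A" by blast
  qed
  then obtain D where D: "T \<subseteq> D" "\<not> derivable D F"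
    and max: "\<And>E. T \<subseteq> E \<Longrightarrow> \<not> derivable E F \<Longrightarrow> D \<subseteq> E \<Longrightarrow> E = D"
    by auto
  have "derivable (insert G D) F" if "G \<notin> D" for G
    using max[of "insert G D"] D(1) that by blast
  then show thesis
    using that D unfolding maximal_avoiding_def by blast
qed

context
  fixes E :: "'a form" and D
  assumes max: "maximal_avoiding E D"
begin

text \<open>Were \<open>F\<close> outside \<open>D\<close>, maximality and deduction would give
  \<open>Imp F E\<close> from \<open>D\<close>, and modus ponens the avoided
  \<open>E\<close>.\<close>

lemma maximal_avoiding_deductively_closed: "derivable D F \<Longrightarrow> F \<in> D"
  using max derivable.mp[OF deduction, of F D E] unfolding maximal_avoiding_def by auto

lemma maximal_avoiding_mp: "Imp F G \<in> D \<Longrightarrow> F \<in> D \<Longrightarrow> G \<in> D"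
  by (rule maximal_avoiding_deductively_closed[OF derivable.mp[OF derivable.hyp derivable.hyp]])

lemma maximal_avoiding_thm: "int_thm F \<Longrightarrow> F \<in> D"
  by (simp add: maximal_avoiding_deductively_closed derivable.ax)

lemma maximal_avoiding_goal: "E \<notin> D"
  using max derivable.hyp unfolding maximal_avoiding_def by blast

lemma maximal_avoiding_Bot: "Bot \<notin> D"
  using maximal_avoiding_goal maximal_avoiding_mp[OF maximal_avoiding_thm[OF int_thm.BotE[of E]]]
  by (rule contrapos_nn)

lemma maximal_avoiding_And: "And F G \<in> D \<longleftrightarrow> F \<in> D \<and> G \<in> D"
  using maximal_avoiding_mp[OF maximal_avoiding_thm[OF int_thm.AndE1[of F G]]]
    maximal_avoiding_mp[OF maximal_avoiding_thm[OF int_thm.AndE2[of F G]]]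
    maximal_avoiding_mp[OF maximal_avoiding_mp[OF maximal_avoiding_thm[OF int_thm.AndI[of F G]]]]
  by (rule iffI[OF conjI]) simp_all

lemma maximal_avoiding_Or: "Or F G \<in> D \<longleftrightarrow> F \<in> D \<or> G \<in> D"
proof
  assume Or: "Or F G \<in> D"
  show "F \<in> D \<or> G \<in> D"
  proof (rule ccontr)
    assume "\<not> (F \<in> D \<or> G \<in> D)"
    \<comment> \<open>By maximality, adding either disjunct derives \<open>E\<close>;
      \<open>OrE\<close> then puts \<open>E\<close> into \<open>D\<close>.\<close>
    then have "Imp F E \<in> D" "Imp G E \<in> D"
      using max deduction maximal_avoiding_deductively_closed
      unfolding maximal_avoiding_def by blast+
    then show False
      using Or maximal_avoiding_goal
        maximal_avoiding_mp[OF maximal_avoiding_mp[OF maximal_avoiding_mp[OF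
          maximal_avoiding_thm[OF int_thm.OrE[of F E G]]]]]
      by simp
  qed
next
  assume "F \<in> D \<or> G \<in> D"
  then show "Or F G \<in> D"
    using maximal_avoiding_mp[OF maximal_avoiding_thm[OF int_thm.OrI1[of F G]]]
      maximal_avoiding_mp[OF maximal_avoiding_thm[OF int_thm.OrI2[of G F]]]
    by (rule disjE)
qed

end

text \<open>Avoiding \<open>Bot\<close> amounts to maximal consistency, so such theories are classical.\<close>

lemma maximal_consistent_sat:
  assumes D: "maximal_avoiding Bot D" and "atoms F \<subseteq> A"
  shows "{a \<in> A. Atom a \<in> D} \<Turnstile> F \<longleftrightarrow> F \<in> D"
  using assms(2)
proof (induction F)
  case (Imp F G)
  have "Imp F G \<in> D" if "F \<notin> D"
  proof -
    \<comment> \<open>This is where \<open>Bot\<close> being the avoided formula matters: whatever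
      is outside \<open>D\<close> is refuted by \<open>D\<close>.\<close>
    have "derivable D (Imp F Bot)"
      using D that deduction unfolding maximal_avoiding_def by blast
    then have "derivable (insert F D) (Imp F Bot)"
      by (rule derivable_mono) blast
    then have "derivable (insert F D) G"
      by (blast intro: derivable.mp[OF derivable.ax[OF int_thm.BotE]] derivable.mp derivable.hyp)
    then show ?thesis
      by (intro maximal_avoiding_deductively_closed[OF D] deduction)
  qed
  moreover have "Imp F G \<in> D" if "G \<in> D"
    using that by (rule maximal_avoiding_mp[OF D maximal_avoiding_thm[OF D int_thm.K]])
  ultimately show ?case
    using Imp maximal_avoiding_mp[OF D, of F G] by auto
qed (use D in \<open>auto simp: maximal_avoiding_Bot maximal_avoiding_And maximal_avoiding_Or\<close>)

section \<open>Here-and-there models\<close>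

text \<open>Forcing at the lower world of the two-world Kripke model with worlds \<open>Y\<close>
  and \<open>X\<close>. The last conjunct for \<open>Imp\<close> accounts for the upper world, where
  forcing is classical.\<close>

primrec ht :: "'a set \<Rightarrow> 'a set \<Rightarrow> 'a form \<Rightarrow> bool" where
  "ht Y X (Atom a) \<longleftrightarrow> a \<in> Y"
| "ht Y X Bot \<longleftrightarrow> False"
| "ht Y X (And F G) \<longleftrightarrow> ht Y X F \<and> ht Y X G"
| "ht Y X (Or F G) \<longleftrightarrow> ht Y X F \<or> ht Y X G"
| "ht Y X (Imp F G) \<longleftrightarrow> (ht Y X F \<longrightarrow> ht Y X G) \<and> X \<Turnstile> Imp F G"

text \<open>Persistence from the lower to the upper world, needed for soundness of axioms such as
  \<open>K\<close>.\<close>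

lemma ht_imp_sat: "Y \<subseteq> X \<Longrightarrow> ht Y X F \<Longrightarrow> X \<Turnstile> F"
  by (induction F) auto

lemma ht_diagonal: "ht X X F \<longleftrightarrow> X \<Turnstile> F"
  by (induction F) auto

lemma int_thm_ht: "int_thm F \<Longrightarrow> Y \<subseteq> X \<Longrightarrow> ht Y X F"
  by (induction rule: int_thm.induct) (auto dest: ht_imp_sat)

lemma derivable_ht:
  assumes "derivable T F" "Y \<subseteq> X" "\<And>G. G \<in> T \<Longrightarrow> ht Y X G"
  shows "ht Y X F"
  using assms(1) by induction (use assms(2,3) int_thm_ht in auto)

lemma derivable_sat: "derivable T F \<Longrightarrow> (\<And>G. G \<in> T \<Longrightarrow> X \<Turnstile> G) \<Longrightarrow> X \<Turnstile> F"
  using derivable_ht[of T F X X] by (simp add: ht_diagonal)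

lemma sat_reduct_self: "nested F \<Longrightarrow> X \<Turnstile> reduct X F \<longleftrightarrow> X \<Turnstile> F"
  by (induction rule: nested.induct) auto

text \<open>By persistence, \<open>Neg F\<close> is forced at \<open>Y\<close> exactly if
  \<open>F\<close> fails in \<open>X\<close>, which is when the reduct turns it into
  \<open>Top\<close>.\<close>

lemma ht_iff_sat_reduct: "nested F \<Longrightarrow> Y \<subseteq> X \<Longrightarrow> ht Y X F \<longleftrightarrow> Y \<Turnstile> reduct X F"
  by (induction rule: nested.induct) (auto simp: sat_reduct_self dest: ht_imp_sat)

section \<open>Min-answer sets\<close>

lemma closed_under_reduct:
  "closed_under Y (program_reduct X P) \<longleftrightarrow>
    (\<forall>C\<in>P. Y \<Turnstile> reduct X (body C) \<longrightarrow> Y \<Turnstile> reduct X (head C))"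
  by (auto simp: closed_under_def program_reduct_def clause_reduct_def)

definition completed_theory :: "'a clause set \<Rightarrow> 'a set \<Rightarrow> 'a form set" where
  "completed_theory P M = clause_form ` P \<union> (Neg \<circ> Atom) ` (program_atoms P - M)"

lemma atoms_completed_theory: "F \<in> completed_theory P M \<Longrightarrow> atoms F \<subseteq> program_atoms P"
  by (auto simp: completed_theory_def program_atoms_def)

lemma sat_completed_theory:
  "N \<subseteq> M \<Longrightarrow> model P N \<Longrightarrow> F \<in> completed_theory P M \<Longrightarrow> N \<Turnstile> F"
  by (auto simp: completed_theory_def model_def)

lemma maximal_consistent_model:
  assumes D: "maximal_avoiding Bot D" and T: "completed_theory P M \<subseteq> D"
  shows "model P {a \<in> program_atoms P. Atom a \<in> D}" "{a \<in> program_atoms P. Atom a \<in> D} \<subseteq> M"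
proof -
  \<comment> \<open>Atoms foreign to \<open>P\<close> are cut off: the theory does not decide them,
    so \<open>D\<close> may contain some outside \<open>M\<close>.\<close>
  let ?N = "{a \<in> program_atoms P. Atom a \<in> D}"
  have sat: "?N \<Turnstile> F" if "F \<in> completed_theory P M" for F
    using that maximal_consistent_sat[OF D atoms_completed_theory[OF that]] T by blast
  show "model P ?N"
    using sat by (auto simp: completed_theory_def model_def)
  show "?N \<subseteq> M"
  proof
    fix a assume a: "a \<in> ?N"
    show "a \<in> M"
    proof (rule ccontr)
      assume "a \<notin> M"
      then have "?N \<Turnstile> Neg (Atom a)"
        using a by (intro sat) (auto simp: completed_theory_def)
      then show False using a by simp
    qed
  qed
qed

section \<open>From consistent derivability to min-answer sets\<close>

lemma min_answer_set_if_consistently_derives: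
  assumes P: "augmented_program P" and "completed_theory P M \<turnstile>\<^sup>c\<^sub>I Atom ` M"
  shows "min_answer_set P M"
proof -
  let ?T = "completed_theory P M"
  have cons: "\<not> derivable ?T Bot" and der: "\<And>a. a \<in> M \<Longrightarrow> derivable ?T (Atom a)"
    using assms(2)
    by (auto simp: consistently_derives_def consistent_def int_derives_iff_derivable)
  have nested: "\<And>C. C \<in> P \<Longrightarrow> nested (head C) \<and> nested (body C)"
    using P by (auto simp: augmented_program_def)
  have sub: "M \<subseteq> N" if "N \<subseteq> M" "model P N" for N
  proof
    fix a assume "a \<in> M"
    then show "a \<in> N"
      using derivable_sat[OF der, of a N] sat_completed_theory[OF that] by auto
  qed
  \<comment> \<open>Consistency supplies some model of \<open>P\<close> below \<open>M\<close>; by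
    \<open>sub\<close> it can only be \<open>M\<close>.\<close>
  obtain D where "?T \<subseteq> D" "maximal_avoiding Bot D"
    using maximal_avoiding_extension[OF cons] .
  then have model: "model P M"
    using maximal_consistent_model[of D P M] sub[of "{a \<in> program_atoms P. Atom a \<in> D}"] by auto
  have "closed_under M (program_reduct M P)"
    using model nested
    by (auto simp: closed_under_reduct sat_reduct_self model_def clause_form_def)
  moreover have "Y = M" if Y: "closed_under Y (program_reduct M P)" "Y \<subseteq> M" for Y
  proof -
    \<comment> \<open>At the lower world clauses hold as \<open>Y\<close> is closed under the
      reduct, at the upper one as \<open>M\<close> is a model.\<close>
    have "ht Y M G" if "G \<in> ?T" for G
      using that Y model nested
      by (auto simp: completed_theory_def clause_form_def model_def closed_under_reduct
          ht_iff_sat_reduct)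
    then have "a \<in> Y" if "a \<in> M" for a
      using derivable_ht[OF der Y(2), of a] that by auto
    then show ?thesis using Y(2) by blast
  qed
  ultimately show ?thesis
    using model sub
    by (auto simp: min_answer_set_def answer_set_def basic_answer_set_def minimal_model_def)
qed

section \<open>From min-answer sets to derivability\<close>

context
  fixes P :: "'a clause set" and M :: "'a set"
  assumes minimal: "minimal_model P M"
begin

lemma maximal_consistent_sat_minimal_model:
  assumes "maximal_avoiding Bot D" "completed_theory P M \<subseteq> D" "atoms F \<subseteq> program_atoms P"
  shows "M \<Turnstile> F \<longleftrightarrow> F \<in> D"
proof -
  have "\<not> {a \<in> program_atoms P. Atom a \<in> D} \<subset> M"
    using maximal_consistent_model(1)[OF assms(1,2)] minimal unfolding minimal_model_def by metis
  then have "{a \<in> program_atoms P. Atom a \<in> D} = M"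
    using maximal_consistent_model(2)[OF assms(1,2)] by (simp add: psubset_eq)
  then show ?thesis
    using maximal_consistent_sat[OF assms(1,3)] by simp
qed

text \<open>\<open>Neg F\<close> belongs to \<open>D\<close> exactly if \<open>F\<close> is
  inconsistent with \<open>D\<close>, and all maximal consistent extensions of \<open>D\<close>
  agree with \<open>M\<close> on \<open>F\<close>.\<close>

lemma maximal_avoiding_Neg_iff:
  assumes D: "maximal_avoiding E D" and T: "completed_theory P M \<subseteq> D"
    and F: "atoms F \<subseteq> program_atoms P"
  shows "Neg F \<in> D \<longleftrightarrow> \<not> M \<Turnstile> F"
proof
  assume neg: "Neg F \<in> D"
  have "\<not> derivable D Bot"
    using maximal_avoiding_Bot[OF D] maximal_avoiding_deductively_closed[OF D] by blast
  then obtain D' where "D \<subseteq> D'" "maximal_avoiding Bot D'"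
    by (rule maximal_avoiding_extension)
  then show "\<not> M \<Turnstile> F"
    using maximal_consistent_sat_minimal_model[of D' "Neg F"] T F neg by auto
next
  assume "\<not> M \<Turnstile> F"
  show "Neg F \<in> D"
  proof (rule ccontr)
    assume "Neg F \<notin> D"
    then have "\<not> derivable (insert F D) Bot"
      using deduction maximal_avoiding_deductively_closed[OF D] by blast
    then obtain D' where "insert F D \<subseteq> D'" "maximal_avoiding Bot D'"
      by (rule maximal_avoiding_extension)
    then show False
      using maximal_consistent_sat_minimal_model[of D' F] T F \<open>\<not> M \<Turnstile> F\<close> by auto
  qed
qed

text \<open>A truth lemma although \<open>D\<close> need not be classical: at negations both the
  reduct and \<open>D\<close> follow \<open>M\<close>, and the other connectives need only
  primeness.\<close>

lemma maximal_avoiding_sat_reduct: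
  assumes D: "maximal_avoiding E D" and T: "completed_theory P M \<subseteq> D"
    and "nested F" "atoms F \<subseteq> program_atoms P"
  shows "{a \<in> program_atoms P. Atom a \<in> D} \<Turnstile> reduct M F \<longleftrightarrow> F \<in> D"
  using assms(3,4)
proof (induction rule: nested.induct)
  case 3
  then show ?case
    using maximal_avoiding_thm[OF D int_thm_refl] by simp
next
  case (6 F)
  then show ?case
    using maximal_avoiding_Neg_iff[OF D T] by (simp add: sat_reduct_self)
qed (use D in \<open>auto simp: maximal_avoiding_Bot maximal_avoiding_And maximal_avoiding_Or\<close>)

lemma answer_set_derivable:
  assumes P: "augmented_program P" and M: "answer_set P M" and "a \<in> M"
  shows "derivable (completed_theory P M) (Atom a)"
proof (rule ccontr)
  assume "\<not> derivable (completed_theory P M) (Atom a)"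
  then obtain D where T: "completed_theory P M \<subseteq> D" and D: "maximal_avoiding (Atom a) D"
    by (rule maximal_avoiding_extension)
  let ?Y = "{a \<in> program_atoms P. Atom a \<in> D}"
  have "closed_under ?Y (program_reduct M P)"
    unfolding closed_under_reduct
  proof (intro ballI impI)
    fix C assume C: "C \<in> P" "?Y \<Turnstile> reduct M (body C)"
    have nested: "nested (head C)" "nested (body C)"
      using P C(1) by (auto simp: augmented_program_def)
    have atoms: "atoms (head C) \<subseteq> program_atoms P" "atoms (body C) \<subseteq> program_atoms P"
      using C(1) by (auto simp: program_atoms_def clause_form_def)
    have "Imp (body C) (head C) \<in> D"
      using T C(1) by (auto simp: completed_theory_def clause_form_def)
    then show "?Y \<Turnstile> reduct M (head C)"
      using C(2) nested atoms maximal_avoiding_mp[OF D]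
      by (auto simp: maximal_avoiding_sat_reduct[OF D T])
  qed
  moreover have "?Y \<subseteq> M"
  proof
    fix b assume b: "b \<in> ?Y"
    show "b \<in> M"
    proof (rule ccontr)
      assume "b \<notin> M"
      then have "Neg (Atom b) \<in> D"
        using b T by (auto simp: completed_theory_def)
      then show False
        using b maximal_avoiding_mp[OF D] maximal_avoiding_Bot[OF D] by blast
    qed
  qed
  \<comment> \<open>\<open>M\<close> is minimal among the sets closed under its reduct. Hence
    \<open>Atom a\<close> would lie in \<open>D\<close>, which avoids it.\<close>
  ultimately have "?Y = M"
    using M by (simp add: answer_set_def basic_answer_set_def)
  then show False
    using \<open>a \<in> M\<close> maximal_avoiding_goal[OF D] by blast
qed

end

theorem theorem5p2:
  fixes P :: "'a clause set" and M :: "'a set"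
  assumes "augmented_program P"
  shows "min_answer_set P M \<longleftrightarrow>
    clause_form ` P \<union> (Neg \<circ> Atom) ` (program_atoms P - M) \<turnstile>\<^sup>c\<^sub>I Atom ` M"
  unfolding completed_theory_def[symmetric]
proof
  assume M: "min_answer_set P M"
  then have "model P M"
    by (simp add: min_answer_set_def minimal_model_def)
  \<comment> \<open>\<open>M\<close> itself is a classical model of the theory, so soundness rules
    out \<open>Bot\<close>.\<close>
  then have "\<not> derivable (completed_theory P M) Bot"
    using derivable_sat[of "completed_theory P M" Bot M] sat_completed_theory by auto
  then show "completed_theory P M \<turnstile>\<^sup>c\<^sub>I Atom ` M"
    using M assms
    by (auto simp: consistently_derives_def consistent_def int_derives_iff_derivable
        min_answer_set_def intro: answer_set_derivable)
next
  assume "completed_theory P M \<turnstile>\<^sup>c\<^sub>I Atom ` M"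
  then show "min_answer_set P M"
    by (rule min_answer_set_if_consistently_derives[OF assms])
qed

end
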